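(* Let $X$ and $Y$ be real or complex Banach spaces, not necessarily over the same field, and let $C$ be a closed, not necessarily proper, cone in $Y$. Let $T:C\to X$ be a surjective continuous additive positively homogeneous map. Furthermore, let $J$ be a finite set, possibly empty, and, for all $j\in J$, let $\rho_{j}:C\to\mathbb{R}$ be a continuous subadditive positively homogeneous map that is bounded from above on $S_{Y}\cap C$, where $S_Y:=\{y\in Y:\|y\|=1\}$. Then there exist constants $K>0$ and $\alpha_{j}\in\mathbb{R}$ $(j\in J)$ and a continuous positively homogeneous map $\gamma:X\to C$ such that: (1) $T\circ\gamma=\mathrm{id}_{X}$; (2) $\|\gamma(x)\|\leq K\|x\|$ for all $x\in X$; (3) $\rho_{j}(\gamma(x))\leq\alpha_{j}\|x\|$ for all $x\in X$ and $j\in J$.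
   Context: A subset $C$ of a real or complex vector space is a cone if $C+C\subseteq C$ and $\lambda C\subseteq C$ for all real $\lambda\geq 0$; it is proper if $C\cap(-C)=\{0\}$ (not assumed here). A map $T$ on a cone is additive if $T(u+v)=Tu+Tv$; a map $T$ on a cone or vector space is positively homogeneous if $T(\lambda u)=\lambda T(u)$ for all $u$ in its domain and all real $\lambda\geq0$; $\rho:C\to\mathbb{R}$ is subadditive if $\rho(u+v)\leq\rho(u)+\rho(v)$ for all $u,v\in C$. *)

theory Defs
  imports "HOL-Analysis.Analysis"
begin

(* The class banach is used for both real and complex Banach spaces: a complex Banach
   space is one of class banach after restricting scalars, with the same norm, and every
   notion below involves real scalars only. *)

(* The library's cone lacks closure under addition; its convex_cone has it, but also
   demands that the set be nonempty. *)
definition additive_cone :: "'a::real_vector set \<Rightarrow> bool" where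
  "additive_cone C \<longleftrightarrow> (\<forall>u\<in>C. \<forall>v\<in>C. u + v \<in> C) \<and> cone C"

definition additive_on :: "'a::real_vector set \<Rightarrow> ('a \<Rightarrow> 'b::real_vector) \<Rightarrow> bool" where
  "additive_on C T \<longleftrightarrow> (\<forall>u\<in>C. \<forall>v\<in>C. T (u + v) = T u + T v)"

definition subadditive_on :: "'a::real_vector set \<Rightarrow> ('a \<Rightarrow> real) \<Rightarrow> bool" where
  "subadditive_on C \<rho> \<longleftrightarrow> (\<forall>u\<in>C. \<forall>v\<in>C. \<rho> (u + v) \<le> \<rho> u + \<rho> v)"

definition pos_homogeneous_on :: "'a::real_vector set \<Rightarrow> ('a \<Rightarrow> 'b::real_vector) \<Rightarrow> bool" where
  "pos_homogeneous_on C T \<longleftrightarrow> (\<forall>u\<in>C. \<forall>l\<ge>0. T (l *\<^sub>R u) = l *\<^sub>R T u)"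

end

theory Submission
  imports Defs
begin

text \<open>
  The bound on \<open>\<rho> j\<close> follows from the one on the norm: homogeneity turns the upper bound \<open>m\<close> on the
  unit sphere into \<open>\<rho> j u \<le> \<bar>m\<bar> * norm u\<close> on all of \<open>C\<close>.
  The content is therefore the existence of a continuous, positively homogeneous right inverse of
  linear growth (\<open>homogeneous_continuous_right_inverse\<close>), a theorem of Bartle-Graves type.

  A continuous positively homogeneous \<^emph>\<open>approximate\<close> right inverse \<open>s\<close>, with
  \<open>norm (T (s x) - x) \<le> norm x / 2\<close>, already suffices. The error \<open>R x = x - T (s x)\<close> is again a
  continuous positively homogeneous self-map of the whole space, so \<open>s\<close> can be applied to the error,
  and to the error of the error, and so on: the sum of all \<open>s (R\<^sup>n x)\<close> converges geometrically, stays
  in the closed cone, and \<open>T\<close> maps its partial sums to the telescoping sums \<open>x - R\<^sup>N x\<close>. This one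
  iteration does the work of both the open mapping theorem and the Michael selection theorem.

  Two ingredients give \<open>s\<close>. By the Baire category theorem, points of the unit ball have approximate
  preimages in \<open>C\<close> of uniformly bounded norm (\<open>approximate_lifts\<close>). Such preimages \<open>c x\<close>, chosen
  without any continuity on the unit sphere, are then averaged (\<open>continuous_average\<close>) into a continuous
  map whose value at \<open>x\<close> is a limit of convex combinations of the \<open>c z\<close> with \<open>z\<close> near \<open>x\<close>. The
  approximate preimages of bounded norm of a point form a closed convex set, which such an average
  cannot leave.
\<close>

section \<open>Continuous averages of bounded functions on metric spaces\<close>

lemma weighted_series_in_closed_convex:
  fixes d :: "nat \<Rightarrow> 'a::real_normed_vector"
  assumes "closed Q" "convex Q"
    and w: "\<And>n. 0 \<le> w n" and d: "\<And>n. 0 < w n \<Longrightarrow> d n \<in> Q"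
    and W: "w sums W" and "0 < W" and V: "(\<lambda>n. w n *\<^sub>R d n) sums V"
  shows "(1 / W) *\<^sub>R V \<in> Q"
proof -
  let ?W = "\<lambda>N. \<Sum>n<N. w n" and ?V = "\<lambda>N. \<Sum>n<N. w n *\<^sub>R d n"
  have limW: "?W \<longlonglongrightarrow> W" and limV: "?V \<longlonglongrightarrow> V"
    using W V by (auto simp: sums_def)
  have lim: "(\<lambda>N. (1 / ?W N) *\<^sub>R ?V N) \<longlonglongrightarrow> (1 / W) *\<^sub>R V"
    using limW limV \<open>0 < W\<close> by (intro tendsto_intros) auto
  have "eventually (\<lambda>N. 0 < ?W N) sequentially"
    using order_tendstoD(1)[OF limW \<open>0 < W\<close>] .
  then have ev: "eventually (\<lambda>N. (1 / ?W N) *\<^sub>R ?V N \<in> Q) sequentially"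
  proof eventually_elim
    fix N assume pos: "0 < ?W N"
    let ?P = "{n. n < N \<and> 0 < w n}"
    have zero: "w n = 0" if "n \<in> {..<N} - ?P" for n
      using that w[of n] by auto
    have "?W N = sum w ?P"
      using zero by (intro sum.mono_neutral_right) auto
    then have one: "(\<Sum>n\<in>?P. w n / ?W N) = 1"
      using pos by (simp flip: sum_divide_distrib)
    have "?V N = (\<Sum>n\<in>?P. w n *\<^sub>R d n)"
      using zero by (intro sum.mono_neutral_right) auto
    then have "(1 / ?W N) *\<^sub>R ?V N = (\<Sum>n\<in>?P. (w n / ?W N) *\<^sub>R d n)"
      by (simp add: scaleR_sum_right)
    also have "\<dots> \<in> Q"
      using pos d one \<open>convex Q\<close> by (intro convex_sum) auto
    finally show "(1 / ?W N) *\<^sub>R ?V N \<in> Q" .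
  qed
  show ?thesis
    using Lim_in_closed_set[OF \<open>closed Q\<close> ev _ lim] by simp
qed

text \<open>
  The function \<open>g\<close> extends to a locally constant function on a neighbourhood of \<open>E\<close>, namely the value
  of \<open>g\<close> at some nearby point \<open>p x\<close> of \<open>E\<close>: two such points chosen for neighbouring arguments are so
  close that \<open>g\<close> agrees on them. Multiplied by a bump function \<open>\<phi>\<close> that vanishes off this
  neighbourhood, it becomes continuous everywhere.
\<close>
lemma bump_extension:
  fixes g :: "'x::metric_space \<Rightarrow> 'y::real_normed_vector"
  assumes "0 < r" and g: "\<And>x y. x \<in> E \<Longrightarrow> y \<in> E \<Longrightarrow> dist x y < r \<Longrightarrow> g x = g y"
  obtains \<phi> p where "continuous_on UNIV \<phi>" "\<And>x. 0 \<le> \<phi> x" "\<And>x. \<phi> x \<le> r"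
    "\<And>x. x \<in> E \<Longrightarrow> 0 < \<phi> x" "\<And>x. 0 < \<phi> x \<Longrightarrow> p x \<in> E \<and> dist x (p x) < r"
    "continuous_on UNIV (\<lambda>x. \<phi> x *\<^sub>R g (p x))"
proof (cases "E = {}")
  case True
  show ?thesis
    by (rule that[of "\<lambda>_. 0" "\<lambda>x. x"]) (use True \<open>0 < r\<close> in auto)
next
  case False
  \<comment> \<open>With radius \<open>r / 4\<close>, points of \<open>E\<close> chosen for two arguments in a common ball of radius \<open>r / 4\<close>
    have distance less than \<open>r\<close>.\<close>
  define \<phi> where "\<phi> x = max 0 (r / 4 - infdist x E)" for x
  define p where "p x = (SOME e. e \<in> E \<and> dist x e < r / 4)" for x
  have p: "p x \<in> E \<and> dist x (p x) < r / 4" if "0 < \<phi> x" for x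
  proof -
    have "infdist x E < r / 4"
      using that by (auto simp: \<phi>_def max_def split: if_splits)
    then have "\<exists>e. e \<in> E \<and> dist x e < r / 4"
      using False cInf_less_iff[of "dist x ` E" "r / 4"] by (auto simp: infdist_notempty)
    then show ?thesis
      unfolding p_def by (rule someI_ex)
  qed
  have cont: "continuous_on UNIV \<phi>"
    unfolding \<phi>_def by (intro continuous_intros)
  have local: "\<exists>v. \<forall>y\<in>ball x (r / 4). \<phi> y *\<^sub>R g (p y) = \<phi> y *\<^sub>R v" for x
  proof (cases "\<exists>z\<in>ball x (r / 4). 0 < \<phi> z")
    case True
    then obtain z where z: "dist x z < r / 4" "0 < \<phi> z"
      by auto
    have "g (p y) = g (p z)" if y: "dist x y < r / 4" "0 < \<phi> y" for y
    proof (rule g)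
      have "dist (p y) (p z) \<le> dist y (p y) + dist x y + dist x z + dist z (p z)"
        by metric
      then show "dist (p y) (p z) < r"
        using p[OF y(2)] p[OF z(2)] y z by linarith
    qed (use p y z in auto)
    then have "\<phi> y *\<^sub>R g (p y) = \<phi> y *\<^sub>R g (p z)" if "y \<in> ball x (r / 4)" for y
      using that by (cases "0 < \<phi> y") (auto simp: \<phi>_def max_def split: if_splits)
    then show ?thesis by blast
  next
    case False
    then have "\<phi> y = 0" if "y \<in> ball x (r / 4)" for y
      using that by (force simp: \<phi>_def max_def)
    then show ?thesis by auto
  qed
  have "isCont (\<lambda>x. \<phi> x *\<^sub>R g (p x)) x" for x
  proof -
    obtain v where v: "\<And>y. y \<in> ball x (r / 4) \<Longrightarrow> \<phi> y *\<^sub>R g (p y) = \<phi> y *\<^sub>R v"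
      using local by blast
    have "continuous_on (ball x (r / 4)) (\<lambda>y. \<phi> y *\<^sub>R g (p y)) \<longleftrightarrow>
          continuous_on (ball x (r / 4)) (\<lambda>y. \<phi> y *\<^sub>R v)"
      using v by (intro continuous_on_cong) auto
    moreover have "continuous_on (ball x (r / 4)) (\<lambda>y. \<phi> y *\<^sub>R v)"
      using cont continuous_on_subset by (intro continuous_intros) blast
    ultimately show ?thesis
      using \<open>0 < r\<close> by (simp add: continuous_on_eq_continuous_at)
  qed
  then have "continuous_on UNIV (\<lambda>x. \<phi> x *\<^sub>R g (p x))"
    by (simp add: continuous_at_imp_continuous_on)
  moreover have "\<phi> x \<le> r" for x
    using \<open>0 < r\<close> infdist_nonneg[of x E] unfolding \<phi>_def by linarith
  moreover have "p x \<in> E \<and> dist x (p x) < r" if "0 < \<phi> x" for x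
    using p[OF that] \<open>0 < r\<close> by linarith
  ultimately show ?thesis
    using \<open>0 < r\<close> cont by (intro that[of \<phi> p]) (auto simp: \<phi>_def)
qed

text \<open>
  This replaces a partition of unity subordinate to the cover of \<open>S\<close> by \<open>\<delta>\<close>-balls, along the lines of
  Stone's proof that metric spaces are paracompact. Well-order \<open>S\<close>, and let \<open>a x\<close> be the first point at
  distance less than \<open>\<delta>\<close> from \<open>x\<close>. On the set \<open>E n\<close> where this distance is at most \<open>\<delta> - r n\<close>, the map
  \<open>a\<close> is constant at scale \<open>r n\<close>: if \<open>x\<close> and \<open>y\<close> in \<open>E n\<close> are closer than \<open>r n\<close>, then
  \<open>a y\<close> competes for \<open>a x\<close> and conversely. So \<open>c \<circ> a\<close> has a weighted continuous extension from every
  \<open>E n\<close>, and the sets \<open>E n\<close> exhaust \<open>S\<close>. As \<open>c\<close> is bounded, these countably many extensions can be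
  summed with geometric weights.
\<close>
lemma continuous_average:
  fixes c :: "'x::metric_space \<Rightarrow> 'y::banach"
  assumes "0 < \<delta>" and "bounded (c ` S)"
  obtains s where "continuous_on S s"
    "\<And>x. x \<in> S \<Longrightarrow> s x \<in> closure (convex hull (c ` (S \<inter> ball x \<delta>)))"
proof -
  obtain M where M: "\<And>x. x \<in> S \<Longrightarrow> norm (c x) \<le> M" and "0 < M"
    using \<open>bounded (c ` S)\<close> unfolding bounded_pos by auto
  obtain R :: "'x rel" where R: "well_order_on S R"
    using well_order_on by blast
  then interpret wo_rel R
    by (simp add: wo_rel_def well_order_on_Well_order)
  have fieldR: "Field R = S"
    using R well_order_on_Field by blast
  define a where "a x = minim (S \<inter> ball x \<delta>)" for x
  have a: "a x \<in> S" "dist x (a x) < \<delta>" "\<And>b. b \<in> S \<Longrightarrow> dist x b < \<delta> \<Longrightarrow> (a x, b) \<in> R"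
    if "x \<in> S" for x
  proof -
    have "isMinim (S \<inter> ball x \<delta>) (a x)"
      unfolding a_def using that \<open>0 < \<delta>\<close> fieldR by (intro minim_isMinim) auto
    then show "a x \<in> S" "dist x (a x) < \<delta>" "\<And>b. b \<in> S \<Longrightarrow> dist x b < \<delta> \<Longrightarrow> (a x, b) \<in> R"
      by (auto simp: isMinim_def)
  qed
  \<comment> \<open>Any positive null sequence bounded by 1 would do.\<close>
  define r where "r n = 1 / (real n + 1)" for n
  define E where "E n = {x \<in> S. dist x (a x) \<le> \<delta> - r n}" for n
  have r: "0 < r n" "r n \<le> 1" for n
    by (auto simp: r_def)
  have sep: "a x = a y" if x: "x \<in> E n" and y: "y \<in> E n" and xy: "dist x y < r n" for n x y
  proof -
    have "dist x (a y) \<le> dist x y + dist y (a y)" "dist y (a x) \<le> dist x y + dist x (a x)"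
      by metric+
    then have "dist x (a y) < \<delta>" "dist y (a x) < \<delta>"
      using x y xy by (auto simp: E_def)
    then have "(a x, a y) \<in> R" "(a y, a x) \<in> R"
      using a x y by (auto simp: E_def)
    then show ?thesis
      using ANTISYM by (auto simp: antisym_def)
  qed
  define layer where "layer n \<phi> p \<longleftrightarrow> continuous_on UNIV \<phi> \<and> (\<forall>x. 0 \<le> \<phi> x \<and> \<phi> x \<le> r n) \<and>
      (\<forall>x\<in>E n. 0 < \<phi> x) \<and> (\<forall>x. 0 < \<phi> x \<longrightarrow> p x \<in> E n \<and> dist x (p x) < r n) \<and>
      continuous_on UNIV (\<lambda>x. \<phi> x *\<^sub>R c (a (p x)))" for n \<phi> p
  have "\<exists>\<phi> p. layer n \<phi> p" for n
  proof (rule bump_extension[of "r n" "E n" "\<lambda>x. c (a x)"])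
    show "c (a x) = c (a y)" if "x \<in> E n" "y \<in> E n" "dist x y < r n" for x y
      using sep[OF that] by simp
  qed (use r in \<open>auto simp: layer_def\<close>)
  then obtain \<phi> p where lay: "\<And>n. layer n (\<phi> n) (p n)"
    by metis
  have \<phi>: "continuous_on UNIV (\<phi> n)" "0 \<le> \<phi> n x" "\<phi> n x \<le> 1" "x \<in> E n \<Longrightarrow> 0 < \<phi> n x" for n x
    using lay[of n] order_trans[OF _ r(2), of _ n] by (auto simp: layer_def)
  have p: "p n x \<in> E n \<and> dist x (p n x) < r n" if "0 < \<phi> n x" for n x
    using lay[of n] that by (simp add: layer_def)
  have \<phi>c: "continuous_on UNIV (\<lambda>x. \<phi> n x *\<^sub>R c (a (p n x)))" for n
    using lay[of n] by (simp add: layer_def)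
  define d where "d n x = c (a (p n x))" for n x
  define w where "w n x = (1 / 2) ^ n * \<phi> n x" for n x
  \<comment> \<open>The margin \<open>r n\<close> in \<open>E n\<close> pays for the step from \<open>x\<close> to \<open>p n x\<close>.\<close>
  have in_ball: "a (p n x) \<in> S \<inter> ball x \<delta>" if "0 < w n x" for n x
  proof -
    have "0 < \<phi> n x"
      using that by (simp add: w_def zero_less_mult_iff)
    note px = p[OF this]
    moreover have "dist x (a (p n x)) \<le> dist x (p n x) + dist (p n x) (a (p n x))"
      by metric
    ultimately show ?thesis
      using a(1) by (auto simp: E_def)
  qed
  have w: "0 \<le> w n x" "w n x \<le> (1 / 2) ^ n" for n x
    using \<phi>(2,3)[of n x] by (auto simp: w_def mult_left_le)
  have wd: "norm (w n x *\<^sub>R d n x) \<le> (1 / 2) ^ n * M" for n x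
  proof (cases "0 < w n x")
    case True
    then have "norm (d n x) \<le> M"
      using in_ball M by (auto simp: d_def)
    then show ?thesis
      using w[of n x] by (auto intro!: mult_mono)
  next
    case False
    then show ?thesis
      using w(1)[of n x] \<open>0 < M\<close> by auto
  qed
  have sm: "summable (\<lambda>n. (1 / 2 :: real) ^ n)" "summable (\<lambda>n. (1 / 2 :: real) ^ n * M)"
    by (auto intro: summable_mult2)
  define W where "W x = (\<Sum>n. w n x)" for x
  define V where "V x = (\<Sum>n. w n x *\<^sub>R d n x)" for x
  have cW: "continuous_on UNIV W"
    unfolding W_def
  proof (rule uniform_limit_theorem)
    show "uniform_limit UNIV (\<lambda>N x. \<Sum>n<N. w n x) (\<lambda>x. \<Sum>n. w n x) sequentially"
      using w by (intro Weierstrass_m_test[OF _ sm(1)]) auto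
    show "\<forall>\<^sub>F N in sequentially. continuous_on UNIV (\<lambda>x. \<Sum>n<N. w n x)"
      unfolding w_def by (intro always_eventually allI continuous_intros \<phi>)
  qed simp
  have cwd: "continuous_on UNIV (\<lambda>x. w n x *\<^sub>R d n x)" for n
    using continuous_on_scaleR[OF continuous_on_const \<phi>c] by (simp add: w_def d_def)
  have cV: "continuous_on UNIV V"
    unfolding V_def
  proof (rule uniform_limit_theorem)
    show "uniform_limit UNIV (\<lambda>N x. \<Sum>n<N. w n x *\<^sub>R d n x) (\<lambda>x. \<Sum>n. w n x *\<^sub>R d n x) sequentially"
      using wd by (intro Weierstrass_m_test[OF _ sm(2)]) auto
    show "\<forall>\<^sub>F N in sequentially. continuous_on UNIV (\<lambda>x. \<Sum>n<N. w n x *\<^sub>R d n x)"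
      by (intro always_eventually allI continuous_intros cwd)
  qed simp
  have smw: "summable (\<lambda>n. w n x)" for x
    using w by (intro summable_comparison_test'[OF sm(1)]) auto
  have smwd: "summable (\<lambda>n. w n x *\<^sub>R d n x)" for x
    using wd by (intro summable_comparison_test'[OF sm(2)]) auto
  have Wpos: "0 < W x" if "x \<in> S" for x
  proof -
    have "0 < \<delta> - dist x (a x)"
      using a(2)[OF that] by simp
    then obtain n where "r n < \<delta> - dist x (a x)"
      unfolding r_def using reals_Archimedean by (metis inverse_eq_divide of_nat_Suc add.commute)
    then have "x \<in> E n"
      using that by (simp add: E_def)
    then have "0 < w n x"
      using \<phi>(4) by (simp add: w_def)
    then show ?thesis
      unfolding W_def using smw w(1) by (intro suminf_pos2[of _ n]) auto
  qed
  show ?thesis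
  proof
    show "continuous_on S (\<lambda>x. (1 / W x) *\<^sub>R V x)"
      using Wpos continuous_on_subset[OF cW] continuous_on_subset[OF cV]
      by (intro continuous_intros) (auto simp: less_imp_neq[symmetric])
    fix x assume "x \<in> S"
    show "(1 / W x) *\<^sub>R V x \<in> closure (convex hull (c ` (S \<inter> ball x \<delta>)))"
    proof (rule weighted_series_in_closed_convex)
      show "(\<lambda>n. w n x) sums W x" "(\<lambda>n. w n x *\<^sub>R d n x) sums V x"
        using smw smwd by (auto simp: W_def V_def summable_sums)
      fix n assume "0 < w n x"
      then have "d n x \<in> c ` (S \<inter> ball x \<delta>)"
        unfolding d_def using in_ball by blast
      then show "d n x \<in> closure (convex hull (c ` (S \<inter> ball x \<delta>)))"
        by (meson closure_subset hull_subset subsetD)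
    qed (use w Wpos \<open>x \<in> S\<close> in \<open>auto intro: convex_closure\<close>)
  qed
qed

section \<open>Approximate right inverses\<close>

lemma zero_in_cone:
  assumes "additive_cone C" and "T ` C = UNIV"
  shows "0 \<in> C"
proof -
  have "C \<noteq> {}"
    using assms(2) by auto
  then obtain u where "u \<in> C"
    by blast
  then have "0 *\<^sub>R u \<in> C"
    using assms(1) unfolding additive_cone_def cone_def by blast
  then show ?thesis
    by simp
qed

lemma pos_homogeneous_zero:
  assumes "pos_homogeneous_on C T" and "0 \<in> C"
  shows "T 0 = 0"
proof -
  have "T (0 *\<^sub>R 0) = 0 *\<^sub>R T 0"
    using assms unfolding pos_homogeneous_on_def by blast
  then show ?thesis
    by simp
qed

text \<open>
  The first half of the open mapping theorem. The closed images of the balls of \<open>C\<close> cover the whole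
  space, so one of them contains a ball, whose centre \<open>x0\<close> need not be 0. Since \<open>C\<close> lacks
  negatives, \<open>x0\<close> cannot be removed by symmetry; adding a preimage \<open>z\<close> of \<open>- x0\<close> does this instead.
\<close>
lemma approximate_lifts:
  fixes C :: "'y::real_normed_vector set" and T :: "'y \<Rightarrow> 'x::banach"
  assumes C: "additive_cone C" and surj: "T ` C = UNIV"
    and add: "additive_on C T" and hom: "pos_homogeneous_on C T" and "0 < \<epsilon>"
  obtains K where "\<And>x. norm x \<le> 1 \<Longrightarrow> \<exists>y\<in>C. norm y \<le> K \<and> norm (T y - x) \<le> \<epsilon>"
proof -
  let ?B = "\<lambda>n::nat. closure (T ` (C \<inter> cball 0 (real n)))"
  have "\<exists>n. interior (?B n) \<noteq> {}"
  proof (rule ccontr)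
    assume "\<not> ?thesis"
    then have thin: "closedin Met_TC.mtopology B \<and> Met_TC.mtopology interior_of B = {}"
      if "B \<in> range ?B" for B
      using that by fastforce
    have "Met_TC.mtopology interior_of \<Union> (range ?B) = {}"
    proof (rule Met_TC.metric_Baire_category_alt)
      show "Met_TC.mcomplete TYPE('x)"
        unfolding mcomplete_iff_complete by (rule complete_UNIV)
      show "countable (range ?B)"
        by simp
    qed (rule thin)
    then have "interior (\<Union> (range ?B)) = {}"
      unfolding mtopology_is_euclidean euclidean_interior_of .
    moreover have "x \<in> \<Union> (range ?B)" for x
    proof -
      have "x \<in> T ` C"
        by (simp add: surj)
      then obtain y where y: "y \<in> C" "x = T y"
        by blast
      obtain n where "norm y \<le> real n"
        using real_arch_simple by blast
      then have "x \<in> T ` (C \<inter> cball 0 (real n))"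
        using y by auto
      then have "x \<in> ?B n"
        by (rule subsetD[OF closure_subset])
      then show ?thesis
        by (rule UN_I[OF UNIV_I])
    qed
    then have "\<Union> (range ?B) = UNIV"
      by (intro UNIV_eq_I[symmetric])
    ultimately show False
      by (simp only: interior_UNIV UNIV_not_empty)
  qed
  then obtain n x0 where "x0 \<in> interior (?B n)"
    by blast
  then obtain r where "0 < r" and r: "cball x0 r \<subseteq> ?B n"
    by (auto simp: mem_interior_cball)
  have "- x0 \<in> T ` C"
    by (simp add: surj)
  then obtain z where z: "z \<in> C" "T z = - x0"
    by fastforce
  have "\<exists>y\<in>C. norm y \<le> (real n + norm z) / r \<and> norm (T y - x) \<le> \<epsilon>" if "norm x \<le> 1" for x
  proof -
    have "x0 + r *\<^sub>R x \<in> cball x0 r"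
      using that \<open>0 < r\<close> by (simp add: dist_norm mult_left_le)
    then have "x0 + r *\<^sub>R x \<in> ?B n"
      using r by blast
    moreover have "0 < r * \<epsilon>"
      using \<open>0 < r\<close> \<open>0 < \<epsilon>\<close> by simp
    ultimately have "\<exists>y\<in>T ` (C \<inter> cball 0 (real n)). dist y (x0 + r *\<^sub>R x) < r * \<epsilon>"
      unfolding closure_approachable by blast
    then obtain u where u: "u \<in> C" "norm u \<le> real n" "dist (T u) (x0 + r *\<^sub>R x) < r * \<epsilon>"
      by auto
    \<comment> \<open>The map \<open>T\<close> sends \<open>u + z\<close> close to \<open>r *\<^sub>R x\<close>.\<close>
    define y where "y = (1 / r) *\<^sub>R (u + z)"
    have uz: "u + z \<in> C"
      using C u z by (simp add: additive_cone_def)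
    then have "y \<in> C"
      using C \<open>0 < r\<close> by (simp add: y_def additive_cone_def cone_def)
    moreover have "norm y \<le> (real n + norm z) / r"
      using u(2) \<open>0 < r\<close> norm_triangle_ineq[of u z] by (simp add: y_def divide_right_mono)
    moreover have "norm (T y - x) \<le> \<epsilon>"
    proof -
      have "T y = (1 / r) *\<^sub>R (T u - x0)"
        using hom add u z uz \<open>0 < r\<close>
        by (simp add: y_def pos_homogeneous_on_def additive_on_def)
      then have "T y - x = (1 / r) *\<^sub>R (T u - (x0 + r *\<^sub>R x))"
        using \<open>0 < r\<close> by (simp add: algebra_simps)
      then have "norm (T y - x) = dist (T u) (x0 + r *\<^sub>R x) / r"
        using \<open>0 < r\<close> by (simp add: dist_norm)
      then show ?thesis
        using u(3) \<open>0 < r\<close> by (simp add: pos_divide_le_eq mult.commute)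
    qed
    ultimately show ?thesis by blast
  qed
  then show ?thesis by (rule that)
qed

lemma convex_near_lifts:
  fixes C :: "'y::real_normed_vector set" and T :: "'y \<Rightarrow> 'x::real_normed_vector"
  assumes C: "additive_cone C" and add: "additive_on C T" and hom: "pos_homogeneous_on C T"
  shows "convex {y \<in> C. norm y \<le> K \<and> norm (T y - x) \<le> \<epsilon>}"
proof (rule convexI)
  fix u v :: 'y and k l :: real
  assume u: "u \<in> {y \<in> C. norm y \<le> K \<and> norm (T y - x) \<le> \<epsilon>}"
    and v: "v \<in> {y \<in> C. norm y \<le> K \<and> norm (T y - x) \<le> \<epsilon>}"
    and kl: "0 \<le> k" "0 \<le> l" "k + l = 1"
  have in_C: "k *\<^sub>R u \<in> C" "l *\<^sub>R v \<in> C" "k *\<^sub>R u + l *\<^sub>R v \<in> C"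
    using C u v kl by (auto simp: additive_cone_def cone_def)
  have eq: "T (k *\<^sub>R u + l *\<^sub>R v) = k *\<^sub>R T u + l *\<^sub>R T v"
    using in_C u v kl add hom by (simp add: additive_on_def pos_homogeneous_on_def)
  have "T u \<in> cball x \<epsilon>" "T v \<in> cball x \<epsilon>" "u \<in> cball 0 K" "v \<in> cball 0 K"
    using u v by (auto simp: dist_norm norm_minus_commute)
  then have "k *\<^sub>R T u + l *\<^sub>R T v \<in> cball x \<epsilon>" "k *\<^sub>R u + l *\<^sub>R v \<in> cball 0 K"
    using kl convex_cball by (meson convexD)+
  then show "k *\<^sub>R u + l *\<^sub>R v \<in> {y \<in> C. norm y \<le> K \<and> norm (T y - x) \<le> \<epsilon>}"
    using in_C eq by (simp add: dist_norm norm_minus_commute add.commute)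
qed

text \<open>
  At the origin, where the direction \<open>x /\<^sub>R norm x\<close> has no limit, continuity comes from the bound \<open>K\<close>.
\<close>
lemma homogeneous_extension_of_sphere_map:
  fixes s0 :: "'x::real_normed_vector \<Rightarrow> 'y::real_normed_vector"
  assumes cont: "continuous_on (sphere 0 1) s0"
    and bound: "\<And>x. x \<in> sphere 0 1 \<Longrightarrow> norm (s0 x) \<le> K"
  defines "s \<equiv> \<lambda>x. norm x *\<^sub>R s0 (x /\<^sub>R norm x)"
  shows "continuous_on UNIV s" "pos_homogeneous_on UNIV s" "norm (s x) \<le> K * norm x"
proof -
  have bd: "norm (s x) \<le> K * norm x" for x
    using bound[of "x /\<^sub>R norm x"] by (cases "x = 0") (simp_all add: s_def mult.commute mult_right_mono)
  then show "norm (s x) \<le> K * norm x" .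
  have "continuous_on (- {0}) (\<lambda>x. s0 (x /\<^sub>R norm x))"
    by (rule continuous_on_compose2[OF cont]) (auto intro!: continuous_intros, metis left_inverse norm_eq_zero)
  then have "continuous_on (- {0}) s"
    unfolding s_def by (intro continuous_intros)
  then have "isCont s x" if "x \<noteq> 0" for x
    using that by (simp add: continuous_on_eq_continuous_at open_Compl)
  moreover have "isCont s 0"
  proof -
    have "((\<lambda>x. K * norm x) \<longlongrightarrow> 0) (at (0::'x))"
      by (auto intro!: tendsto_eq_intros)
    then have "(s \<longlongrightarrow> 0) (at 0)"
      by (rule Lim_null_comparison[rotated]) (simp add: bd)
    then show ?thesis
      by (simp add: isCont_def s_def)
  qed
  ultimately show "continuous_on UNIV s"
    by (metis continuous_at_imp_continuous_on)
  show "pos_homogeneous_on UNIV s"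
    unfolding pos_homogeneous_on_def
  proof (intro ballI allI impI)
    fix x :: 'x and l :: real assume "0 \<le> l"
    show "s (l *\<^sub>R x) = l *\<^sub>R s x"
    proof (cases "l = 0")
      case False
      with \<open>0 \<le> l\<close> have "(l *\<^sub>R x) /\<^sub>R norm (l *\<^sub>R x) = x /\<^sub>R norm x"
        by simp
      then show ?thesis
        using \<open>0 \<le> l\<close> by (simp only: s_def) simp
    qed (simp add: s_def)
  qed
qed

text \<open>
  Half of the error \<open>\<epsilon>\<close> goes into the choice of the approximate preimages \<open>c z\<close>, the other half
  into the distance between \<open>z\<close> and the point \<open>x\<close> at which they are averaged.
\<close>
lemma approximate_homogeneous_selection:
  fixes C :: "'y::banach set" and T :: "'y \<Rightarrow> 'x::banach"
  assumes "closed C" and C: "additive_cone C" and surj: "T ` C = UNIV"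
    and cont: "continuous_on C T" and add: "additive_on C T" and hom: "pos_homogeneous_on C T"
    and "0 < \<epsilon>"
  obtains s K where "range s \<subseteq> C" "continuous_on UNIV s" "pos_homogeneous_on UNIV s"
    "\<And>x. norm (s x) \<le> K * norm x" "\<And>x. norm (T (s x) - x) \<le> \<epsilon> * norm x"
proof -
  obtain K where "\<And>x. norm x \<le> 1 \<Longrightarrow> \<exists>y\<in>C. norm y \<le> K \<and> norm (T y - x) \<le> \<epsilon> / 2"
    using approximate_lifts[OF C surj add hom, of "\<epsilon> / 2"] \<open>0 < \<epsilon>\<close> by auto
  then obtain c where c: "\<And>x. norm x \<le> 1 \<Longrightarrow> c x \<in> C \<and> norm (c x) \<le> K \<and> norm (T (c x) - x) \<le> \<epsilon> / 2"
    by metis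
  let ?S = "sphere (0::'x) 1"
  have "bounded (c ` ?S)"
    unfolding bounded_iff using c by (intro exI[of _ K]) simp
  moreover have "0 < \<epsilon> / 2"
    using \<open>0 < \<epsilon>\<close> by simp
  ultimately obtain s0 where s0: "continuous_on ?S s0" and
    s0c: "\<And>x. x \<in> ?S \<Longrightarrow> s0 x \<in> closure (convex hull (c ` (?S \<inter> ball x (\<epsilon> / 2))))"
    using continuous_average by blast
  have near: "s0 x \<in> C" "norm (s0 x) \<le> K" "norm (T (s0 x) - x) \<le> \<epsilon>" if "x \<in> ?S" for x
  proof -
    let ?Q = "{y \<in> C. norm y \<le> K \<and> norm (T y - x) \<le> \<epsilon>}"
    have "c ` (?S \<inter> ball x (\<epsilon> / 2)) \<subseteq> ?Q"
    proof
      fix y assume "y \<in> c ` (?S \<inter> ball x (\<epsilon> / 2))"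
      then obtain z where z: "norm z = 1" "norm (z - x) < \<epsilon> / 2" "y = c z"
        by (auto simp: dist_norm norm_minus_commute)
      then have "norm (T y - x) \<le> norm (T (c z) - z) + norm (z - x)"
        using norm_triangle_ineq[of "T (c z) - z" "z - x"] by simp
      then show "y \<in> ?Q"
        using c[of z] z by auto
    qed
    then have hull: "convex hull (c ` (?S \<inter> ball x (\<epsilon> / 2))) \<subseteq> ?Q"
      by (intro hull_minimal convex_near_lifts[OF C add hom])
    have "continuous_on C (\<lambda>y. norm (T y - x))"
      by (intro continuous_intros cont)
    then have "closed {y \<in> C. norm (T y - x) \<le> \<epsilon>}"
      using continuous_closed_preimage[OF _ \<open>closed C\<close> closed_atMost, of "\<lambda>y. norm (T y - x)" \<epsilon>]
      by (simp add: vimage_def Int_def)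
    then have "closed ({y \<in> C. norm (T y - x) \<le> \<epsilon>} \<inter> cball 0 K)"
      by (intro closed_Int) auto
    also have "{y \<in> C. norm (T y - x) \<le> \<epsilon>} \<inter> cball 0 K = ?Q"
      by auto
    finally have "closed ?Q" .
    with hull have "closure (convex hull (c ` (?S \<inter> ball x (\<epsilon> / 2)))) \<subseteq> ?Q"
      by (rule closure_minimal)
    with s0c[OF that] show "s0 x \<in> C" "norm (s0 x) \<le> K" "norm (T (s0 x) - x) \<le> \<epsilon>"
      by auto
  qed
  define s where "s x = norm x *\<^sub>R s0 (x /\<^sub>R norm x)" for x
  have sphere: "x /\<^sub>R norm x \<in> ?S" if "x \<noteq> 0" for x :: 'x
    using that by simp
  have "0 \<in> C"
    using C surj by (rule zero_in_cone)
  have T0: "T 0 = 0"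
    using hom \<open>0 \<in> C\<close> by (rule pos_homogeneous_zero)
  show ?thesis
  proof
    show "continuous_on UNIV s" "pos_homogeneous_on UNIV s" "norm (s x) \<le> K * norm x" for x
      unfolding s_def by (rule homogeneous_extension_of_sphere_map[OF s0 near(2)]; assumption)+
    have "s x \<in> C \<and> norm (T (s x) - x) \<le> \<epsilon> * norm x" for x
    proof (cases "x = 0")
      case True
      then show ?thesis using \<open>0 \<in> C\<close> T0 by (simp add: s_def)
    next
      case False
      let ?u = "x /\<^sub>R norm x"
      note u = near[OF sphere[OF False]]
      have "s x \<in> C"
        using u(1) C by (simp add: s_def additive_cone_def cone_def)
      have "T (s x) = norm x *\<^sub>R T (s0 ?u)"
        using hom u(1) by (simp add: s_def pos_homogeneous_on_def)
      then have "T (s x) - x = norm x *\<^sub>R (T (s0 ?u) - ?u)"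
        using False by (simp add: algebra_simps)
      then have "norm (T (s x) - x) = norm (T (s0 ?u) - ?u) * norm x"
        by simp
      also have "\<dots> \<le> \<epsilon> * norm x"
        using u(3) by (intro mult_right_mono) auto
      finally show ?thesis using \<open>s x \<in> C\<close> by simp
    qed
    then show "range s \<subseteq> C" "norm (T (s x) - x) \<le> \<epsilon> * norm x" for x
      by auto
  qed
qed

section \<open>The right inverse\<close>

text \<open>
  With \<open>R x = x - T (s x)\<close> for an approximate right inverse \<open>s\<close>, the right inverse is the series
  \<open>\<gamma> x = (\<Sum>n. s (R\<^sup>n x))\<close>. Bounding \<open>R\<^sup>n x\<close> by \<open>norm x / 2\<^sup>n\<close> makes it converge uniformly on
  balls, which gives continuity; homogeneity passes from \<open>s\<close> and \<open>R\<close> to \<open>\<gamma>\<close> term by term.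
\<close>
theorem homogeneous_continuous_right_inverse:
  fixes C :: "'y::banach set" and T :: "'y \<Rightarrow> 'x::banach"
  assumes "closed C" and C: "additive_cone C" and surj: "T ` C = UNIV"
    and cont: "continuous_on C T" and add: "additive_on C T" and hom: "pos_homogeneous_on C T"
  obtains \<gamma> K where "0 < K" "range \<gamma> \<subseteq> C" "continuous_on UNIV \<gamma>" "pos_homogeneous_on UNIV \<gamma>"
    "\<And>x. T (\<gamma> x) = x" "\<And>x. norm (\<gamma> x) \<le> K * norm x"
proof -
  obtain s K0 where sC: "range s \<subseteq> C" and s_cont: "continuous_on UNIV s"
    and s_hom: "pos_homogeneous_on UNIV s" and s_bd: "\<And>x. norm (s x) \<le> K0 * norm x"
    and s_near: "\<And>x. norm (T (s x) - x) \<le> 1/2 * norm x"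
    using approximate_homogeneous_selection[OF assms, of "1/2"] by auto
  define K where "K = max 1 K0"
  have "0 < K"
    by (simp add: K_def)
  have s_le: "norm (s x) \<le> K * norm x" for x
    using s_bd[of x] by (rule order_trans) (simp add: K_def mult_right_mono)
  define R where "R n = ((\<lambda>x. x - T (s x)) ^^ n)" for n
  have R0: "R 0 x = x" and RSuc: "R (Suc n) x = R n x - T (s (R n x))" for n x
    by (simp_all add: R_def)
  have R_small: "norm (R n x) \<le> (1/2) ^ n * norm x" for n x
  proof (induction n)
    case (Suc n)
    have "norm (R (Suc n) x) \<le> 1/2 * norm (R n x)"
      using s_near[of "R n x"] by (simp add: RSuc norm_minus_commute)
    with Suc show ?case by simp
  qed (simp add: R0)
  have R_cont: "continuous_on UNIV (R n)" for n
  proof (induction n)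
    case 0
    then show ?case by (simp add: R0 cong: continuous_on_cong)
  next
    case (Suc n)
    have sR: "continuous_on UNIV (\<lambda>x. s (R n x))"
      by (rule continuous_on_compose2[OF s_cont Suc]) simp
    have "continuous_on UNIV (\<lambda>x. T (s (R n x)))"
      by (rule continuous_on_compose2[OF cont sR]) (use sC in auto)
    with Suc show ?case
      by (simp add: RSuc continuous_on_diff cong: continuous_on_cong)
  qed
  have R_hom: "R n (l *\<^sub>R x) = l *\<^sub>R R n x" if "0 \<le> l" for n l x
  proof (induction n)
    case (Suc n)
    have "T (s (l *\<^sub>R R n x)) = l *\<^sub>R T (s (R n x))"
      using s_hom hom range_subsetD[OF sC] that by (simp add: pos_homogeneous_on_def)
    with Suc show ?case
      by (simp add: RSuc scaleR_diff_right)
  qed (simp add: R0)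
  have term_le: "norm (s (R n x)) \<le> (1/2) ^ n * (K * norm x)" for n x
    using order_trans[OF s_le mult_left_mono[OF R_small, of K]] \<open>0 < K\<close> by (simp add: mult_ac)
  have maj: "(\<lambda>n. (1/2) ^ n * b) sums (2 * b)" for b :: real
    using sums_mult2[OF geometric_sums[of "1/2::real"], of b] by simp
  have sm: "summable (\<lambda>n. norm (s (R n x)))" for x
    using term_le by (intro summable_comparison_test'[OF sums_summable[OF maj]]) auto
  define \<gamma> where "\<gamma> x = (\<Sum>n. s (R n x))" for x
  have sums: "(\<lambda>n. s (R n x)) sums \<gamma> x" for x
    unfolding \<gamma>_def by (rule summable_sums[OF summable_norm_cancel[OF sm]])
  then have lim: "(\<lambda>N. \<Sum>n<N. s (R n x)) \<longlonglongrightarrow> \<gamma> x" for x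
    by (simp add: sums_def)
  have "0 \<in> C"
    using C surj by (rule zero_in_cone)
  have T0: "T 0 = 0"
    using hom \<open>0 \<in> C\<close> by (rule pos_homogeneous_zero)
  have partial: "(\<Sum>n<N. s (R n x)) \<in> C \<and> T (\<Sum>n<N. s (R n x)) = x - R N x" for N x
  proof (induction N)
    case 0
    then show ?case using \<open>0 \<in> C\<close> T0 by (simp add: R0)
  next
    case (Suc N)
    have "s (R N x) \<in> C"
      using range_subsetD[OF sC] .
    with Suc show ?case
      using C add by (simp add: additive_cone_def additive_on_def RSuc)
  qed
  have \<gamma>C: "\<gamma> x \<in> C" for x
    by (rule Lim_in_closed_set[OF \<open>closed C\<close> _ _ lim[of x]]) (simp_all add: partial)
  have "T (\<gamma> x) = x" for x
  proof (rule LIMSEQ_unique)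
    show "(\<lambda>N. T (\<Sum>n<N. s (R n x))) \<longlonglongrightarrow> T (\<gamma> x)"
      by (rule continuous_on_tendsto_compose[OF cont lim \<gamma>C]) (simp add: partial)
    have "(\<lambda>N. (1/2) ^ N * norm x) \<longlonglongrightarrow> 0"
      using summable_LIMSEQ_zero[OF sums_summable[OF maj]] .
    then have "(\<lambda>N. R N x) \<longlonglongrightarrow> 0"
      by (rule Lim_null_comparison[rotated]) (use R_small in simp)
    then show "(\<lambda>N. T (\<Sum>n<N. s (R n x))) \<longlonglongrightarrow> x"
      using tendsto_diff[OF tendsto_const[of x], of "\<lambda>N. R N x" 0 sequentially] by (simp add: partial)
  qed
  moreover have "continuous_on UNIV \<gamma>"
  proof -
    have "continuous_on (ball 0 b) \<gamma>" for b
      unfolding \<gamma>_def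
    proof (rule uniform_limit_theorem)
      have "norm (s (R n x)) \<le> (1/2) ^ n * (K * b)" if "x \<in> ball 0 b" for n x
      proof -
        have "(1/2) ^ n * (K * norm x) \<le> (1/2) ^ n * (K * b)"
          using that \<open>0 < K\<close> by (intro mult_left_mono) auto
        with term_le show ?thesis by (rule order_trans)
      qed
      then show "uniform_limit (ball 0 b) (\<lambda>N x. \<Sum>n<N. s (R n x)) (\<lambda>x. \<Sum>n. s (R n x)) sequentially"
        by (rule Weierstrass_m_test[OF _ sums_summable[OF maj]])
      show "\<forall>\<^sub>F N in sequentially. continuous_on (ball 0 b) (\<lambda>x. \<Sum>n<N. s (R n x))"
        using continuous_on_subset[OF continuous_on_compose2[OF s_cont R_cont]]
        by (intro always_eventually allI continuous_intros) auto
    qed simp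
    then have "isCont \<gamma> x" for x
      using continuous_on_interior[of "ball 0 (norm x + 1)" \<gamma> x] by simp
    then show ?thesis
      by (simp add: continuous_at_imp_continuous_on)
  qed
  moreover have "pos_homogeneous_on UNIV \<gamma>"
    unfolding pos_homogeneous_on_def
  proof (intro ballI allI impI)
    fix x :: 'x and l :: real assume "0 \<le> l"
    then have "(\<lambda>n. s (R n (l *\<^sub>R x))) = (\<lambda>n. l *\<^sub>R s (R n x))"
      using R_hom s_hom by (auto simp: pos_homogeneous_on_def)
    then show "\<gamma> (l *\<^sub>R x) = l *\<^sub>R \<gamma> x"
      using sums_scaleR_right[OF sums, of l x] by (simp add: \<gamma>_def sums_iff)
  qed
  moreover have "norm (\<gamma> x) \<le> 2 * K * norm x" for x
    using norm_suminf_le[OF term_le sums_summable[OF maj], of x] sums_unique[OF maj, of "K * norm x"]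
    by (simp add: \<gamma>_def mult.assoc)
  ultimately show ?thesis
    using \<gamma>C \<open>0 < K\<close> by (intro that[of "2 * K" \<gamma>]) auto
qed

theorem theorem3p6:
  fixes C :: "'y::banach set"
    and T :: "'y \<Rightarrow> 'x::banach"
    and J :: "'j set"
    and \<rho> :: "'j \<Rightarrow> 'y \<Rightarrow> real"
  assumes "closed C" and "additive_cone C"
    and "T ` C = UNIV"
    and "continuous_on C T" and "additive_on C T" and "pos_homogeneous_on C T"
    and "finite J"
    and "\<And>j. j \<in> J \<Longrightarrow> continuous_on C (\<rho> j)"
    and "\<And>j. j \<in> J \<Longrightarrow> subadditive_on C (\<rho> j)"
    and "\<And>j. j \<in> J \<Longrightarrow> pos_homogeneous_on C (\<rho> j)"
    and "\<And>j. j \<in> J \<Longrightarrow> bdd_above (\<rho> j ` (sphere 0 1 \<inter> C))"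
  shows "\<exists>(K::real) (\<alpha> :: 'j \<Rightarrow> real) (\<gamma> :: 'x \<Rightarrow> 'y).
           K > 0 \<and> range \<gamma> \<subseteq> C \<and> continuous_on UNIV \<gamma> \<and> pos_homogeneous_on UNIV \<gamma> \<and>
           T \<circ> \<gamma> = id \<and>
           (\<forall>x. norm (\<gamma> x) \<le> K * norm x) \<and>
           (\<forall>x. \<forall>j\<in>J. \<rho> j (\<gamma> x) \<le> \<alpha> j * norm x)"
proof -
  obtain \<gamma> K where \<gamma>: "0 < K" "range \<gamma> \<subseteq> C" "continuous_on UNIV \<gamma>" "pos_homogeneous_on UNIV \<gamma>"
      "\<And>x. T (\<gamma> x) = x" "\<And>x. norm (\<gamma> x) \<le> K * norm x"
    by (rule homogeneous_continuous_right_inverse[OF assms(1-6)]) (rule that)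
  have "\<exists>\<alpha>. \<forall>x. \<rho> j (\<gamma> x) \<le> \<alpha> * norm x" if j: "j \<in> J" for j
  proof -
    obtain m where m: "\<And>u. u \<in> sphere 0 1 \<inter> C \<Longrightarrow> \<rho> j u \<le> m"
      using assms(11)[OF j] unfolding bdd_above_def by blast
    have hom: "\<rho> j (l *\<^sub>R u) = l * \<rho> j u" if "u \<in> C" "0 \<le> l" for l u
      using assms(10)[OF j] that by (simp add: pos_homogeneous_on_def)
    have on_C: "\<rho> j u \<le> \<bar>m\<bar> * norm u" if "u \<in> C" for u
    proof (cases "u = 0")
      case True
      then show ?thesis using hom[of u 0] that by simp
    next
      case False
      let ?e = "u /\<^sub>R norm u"
      have e: "?e \<in> sphere 0 1 \<inter> C"
        using assms(2) that False by (simp add: additive_cone_def cone_def)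
      have "\<rho> j u = norm u * \<rho> j ?e"
        using hom[of ?e "norm u"] e False by simp
      also have "\<dots> \<le> norm u * \<bar>m\<bar>"
        using m[OF e] by (intro mult_left_mono) auto
      finally show ?thesis by (simp add: mult.commute)
    qed
    have "\<rho> j (\<gamma> x) \<le> \<bar>m\<bar> * K * norm x" for x
    proof -
      have "\<rho> j (\<gamma> x) \<le> \<bar>m\<bar> * norm (\<gamma> x)"
        using on_C \<gamma>(2) by blast
      also have "\<dots> \<le> \<bar>m\<bar> * (K * norm x)"
        using \<gamma>(6) by (intro mult_left_mono) auto
      finally show ?thesis by (simp add: mult.assoc)
    qed
    then show ?thesis by blast
  qed
  then obtain \<alpha> where "\<And>j x. j \<in> J \<Longrightarrow> \<rho> j (\<gamma> x) \<le> \<alpha> j * norm x"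
    by metis
  then show ?thesis
    using \<gamma> by (intro exI[of _ K] exI[of _ \<alpha>] exI[of _ \<gamma>]) auto
qed

end
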